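(* Let $P^0\in\mathcal P_0$. The sequence generated from $P^0$ by the model-based simultaneous policy update algorithm and the Newton sequence of $\mathscr F$ started at $P^0$ are equivalent. That is, let $\{P^i\}_{i=0}^\infty\subset\mathcal S^n$ be a sequence with initial term $P^0$ for which $\mathscr F'(P^i)$ is invertible for all $i$ (so that the Newton map is defined along it); then $$P^{i+1}\overline A^i+(\overline A^i)^\top P^{i+1}+A_1^\top P^{i+1}A_1+\overline Q^i=0\quad\text{for all } i\ge0$$ if and only if $$P^{i+1}=P^i-(\mathscr F'(P^i))^{-1}\mathscr F(P^i)\quad\text{for all } i\ge0,$$ where $\overline A^i=A-BR^{-1}B^\top P^i+\gamma^{-2}EE^\top P^i$ and $\overline Q^i=Q+P^iBR^{-1}B^\top P^i-\gamma^{-2}P^iEE^\top P^i$.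
   Context: $\mathcal S^n$ ($\mathcal S^n_+$): real symmetric (positive semidefinite) $n\times n$ matrices; $\|\cdot\|_F$: Frobenius norm. $A,A_1\in\mathbb R^{n\times n}$, $B\in\mathbb R^{n\times m}$, $E\in\mathbb R^{n\times p}$, $C$, $D$ are constant real matrices, $D$ of full column rank, $Q=C^\top C$, $R=D^\top D$ (positive definite), $\gamma>0$. $\mathscr F:\mathcal S^n\to\mathcal S^n$ is $\mathscr F(P)=PA+A^\top P+A_1^\top PA_1-PBR^{-1}B^\top P+\gamma^{-2}PEE^\top P+Q$; its Fréchet derivative at $P$ is $\mathscr F'(P)\Delta=\Delta\mathscr A(P)+\mathscr A(P)^\top\Delta+A_1^\top\Delta A_1$ with $\mathscr A(P)=A-BR^{-1}B^\top P+\gamma^{-2}EE^\top P$. $P^*\succeq0$ is the stabilizing solution of $\mathscr F(P)=0$, i.e. the one for which $dx=\mathscr A(P^* )x\,dt+A_1x\,dW$ ($W$ a standard one-dimensional Brownian motion) satisfies $\mathbb E\|x(t)\|^2\to0$ for every deterministic $x(0)$. With $c_0>0$ a Lipschitz constant of $P\mapsto\mathscr F'(P)$ (operator norm induced by $\|\cdot\|_F$) and $a_0>0$ such that $\|(\mathscr F'(P^* ))^{-1}\|\le a_0$, $\mathcal P_0=\{P\in\mathcal S^n_+:\|P-P^*\|_F\le\frac{2-\sqrt2}{2c_0a_0}\}$ is the set of admissible initial matrices of the algorithm. *)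

theory Defs
  imports "HOL-Probability.Probability"
begin

text \<open>
  On \<^typ>\<open>real^'n^'m\<close> the library's \<^const>\<open>norm\<close> is the Frobenius norm.
\<close>

definition sym_mats :: "(real^'n^'n) set"
  where "sym_mats = {P. transpose P = P}"

definition psd_mats :: "(real^'n^'n) set"
  where "psd_mats = {P \<in> sym_mats. \<forall>x. 0 \<le> x \<bullet> (P *v x)}"

text \<open>Norm of a linear operator on the subspace of symmetric matrices; compare \<^const>\<open>onorm\<close>.\<close>

definition sym_onorm :: "(real^'n^'n \<Rightarrow> real^'n^'n) \<Rightarrow> real"
  where "sym_onorm L = (SUP \<Delta>\<in>sym_mats. norm (L \<Delta>) / norm \<Delta>)"


section \<open>The generalized Riccati operator\<close>

definition closed_loop ::
    "real^'n^'n \<Rightarrow> real^'m^'n \<Rightarrow> real^'m^'q \<Rightarrow> real^'p^'n \<Rightarrow> real \<Rightarrow> real^'n^'n \<Rightarrow> real^'n^'n"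
  where "closed_loop A B D E \<gamma> P =
    A - B ** matrix_inv (transpose D ** D) ** transpose B ** P
      + (1 / \<gamma>\<^sup>2) *\<^sub>R (E ** transpose E ** P)"

definition policy_weight ::
    "real^'m^'n \<Rightarrow> real^'n^'r \<Rightarrow> real^'m^'q \<Rightarrow> real^'p^'n \<Rightarrow> real \<Rightarrow> real^'n^'n \<Rightarrow> real^'n^'n"
  where "policy_weight B C D E \<gamma> P =
    transpose C ** C
      + P ** B ** matrix_inv (transpose D ** D) ** transpose B ** P
      - (1 / \<gamma>\<^sup>2) *\<^sub>R (P ** E ** transpose E ** P)"

definition ric ::
    "real^'n^'n \<Rightarrow> real^'n^'n \<Rightarrow> real^'m^'n \<Rightarrow> real^'n^'r \<Rightarrow> real^'m^'q \<Rightarrow> real^'p^'n \<Rightarrow> real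
      \<Rightarrow> real^'n^'n \<Rightarrow> real^'n^'n"
  where "ric A A\<^sub>1 B C D E \<gamma> P =
    P ** A + transpose A ** P + transpose A\<^sub>1 ** P ** A\<^sub>1
      - P ** B ** matrix_inv (transpose D ** D) ** transpose B ** P
      + (1 / \<gamma>\<^sup>2) *\<^sub>R (P ** E ** transpose E ** P)
      + transpose C ** C"

definition ric_deriv ::
    "real^'n^'n \<Rightarrow> real^'n^'n \<Rightarrow> real^'m^'n \<Rightarrow> real^'m^'q \<Rightarrow> real^'p^'n \<Rightarrow> real
      \<Rightarrow> real^'n^'n \<Rightarrow> real^'n^'n \<Rightarrow> real^'n^'n"
  where "ric_deriv A A\<^sub>1 B D E \<gamma> P \<Delta> =
    \<Delta> ** closed_loop A B D E \<gamma> P + transpose (closed_loop A B D E \<gamma> P) ** \<Delta>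
      + transpose A\<^sub>1 ** \<Delta> ** A\<^sub>1"

definition ric_deriv_inv ::
    "real^'n^'n \<Rightarrow> real^'n^'n \<Rightarrow> real^'m^'n \<Rightarrow> real^'m^'q \<Rightarrow> real^'p^'n \<Rightarrow> real
      \<Rightarrow> real^'n^'n \<Rightarrow> real^'n^'n \<Rightarrow> real^'n^'n"
  where "ric_deriv_inv A A\<^sub>1 B D E \<gamma> P = inv_into sym_mats (ric_deriv A A\<^sub>1 B D E \<gamma> P)"

lemma transpose_diff': "transpose (X - Y) = transpose X - transpose (Y::real^'n^'m)"
  by (simp add: transpose_def vec_eq_iff)

lemma transpose_add': "transpose (X + Y) = transpose X + transpose (Y::real^'n^'m)"
  by (simp add: transpose_def vec_eq_iff)

lemma transpose_scaleR': "transpose (c *\<^sub>R X) = c *\<^sub>R transpose (X::real^'n^'m)"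
  by (simp add: transpose_def vec_eq_iff)

lemma transpose_matrix_inv_gram:
  fixes D :: "real^'m^'q"
  assumes "rank D = CARD('m)"
  shows "transpose (matrix_inv (transpose D ** D)) = matrix_inv (transpose D ** D)"
proof -
  let ?R = "transpose D ** D"
  have "x = 0" if "?R *v x = 0" for x
  proof -
    have "(D *v x) \<bullet> (D *v x) = x \<bullet> (?R *v x)"
      by (metis dot_lmul_matrix inner_commute matrix_vector_mul_assoc transpose_matrix_vector)
    then have "D *v x = 0"
      using that by simp
    then show ?thesis
      using assms full_rank_injective[of D] matrix_left_invertible_injective[of D]
      by (metis injD matrix_vector_mult_0_right)
  qed
  then obtain S where "S ** ?R = mat 1"
    using matrix_left_invertible_ker[of ?R] by blast
  then have inv: "invertible ?R"
    using invertible_left_inverse by blast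
  have mi: "?R ** matrix_inv ?R = mat 1"
    unfolding matrix_inv_def by (rule someI2_ex) (use inv in \<open>auto simp: invertible_def\<close>)
  have "transpose ?R = ?R"
    by (simp add: matrix_transpose_mul)
  then have "transpose (matrix_inv ?R) ** ?R = mat 1"
    by (metis mi matrix_transpose_mul transpose_mat)
  then show ?thesis
    by (metis mi matrix_mul_assoc matrix_mul_lid matrix_mul_rid)
qed

lemma ric_in_sym_mats:
  assumes "rank (D :: real^'m^'q) = CARD('m)" "P \<in> sym_mats"
  shows "ric A A\<^sub>1 B C D E \<gamma> P \<in> sym_mats"
  using assms(2) transpose_matrix_inv_gram[OF assms(1)]
  by (simp add: sym_mats_def ric_def transpose_add' transpose_diff' transpose_scaleR'
      matrix_transpose_mul matrix_mul_assoc algebra_simps)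

lemma ric_deriv_in_sym_mats:
  assumes "\<Delta> \<in> sym_mats"
  shows "ric_deriv A A\<^sub>1 B D E \<gamma> P \<Delta> \<in> sym_mats"
  using assms
  by (simp add: sym_mats_def ric_deriv_def transpose_add' matrix_transpose_mul matrix_mul_assoc
      algebra_simps)

lemma bounded_bilinear_matrix_mult:
  "bounded_bilinear ((**) :: real^'n^'m \<Rightarrow> real^'k^'n \<Rightarrow> real^'k^'m)"
proof -
  have "bilinear ((**) :: real^'n^'m \<Rightarrow> real^'k^'n \<Rightarrow> real^'k^'m)"
    unfolding bilinear_def
    by (intro conjI allI linearI)
      (simp_all add: matrix_matrix_mult_def vec_eq_iff sum.distrib algebra_simps sum_distrib_left)
  then show ?thesis
    by (simp add: bilinear_conv_bounded_bilinear)
qed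

lemma ric_has_derivative:
  assumes "rank (D :: real^'m^'q) = CARD('m)" "P \<in> sym_mats"
  shows "(ric A A\<^sub>1 B C D E \<gamma> has_derivative ric_deriv A A\<^sub>1 B D E \<gamma> P) (at P within sym_mats)"
proof -
  note mult = bounded_bilinear.FDERIV[OF bounded_bilinear_matrix_mult]
  have P: "transpose P = P"
    using assms(2) by (simp add: sym_mats_def)
  note simps = closed_loop_def ric_deriv_def transpose_add' transpose_diff' transpose_scaleR'
      matrix_transpose_mul P transpose_matrix_inv_gram[OF assms(1)]
      bounded_bilinear.add_left[OF bounded_bilinear_matrix_mult]
      bounded_bilinear.add_right[OF bounded_bilinear_matrix_mult]
      bounded_bilinear.diff_left[OF bounded_bilinear_matrix_mult]
      bounded_bilinear.diff_right[OF bounded_bilinear_matrix_mult]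
      bounded_bilinear.zero_left[OF bounded_bilinear_matrix_mult]
      bounded_bilinear.zero_right[OF bounded_bilinear_matrix_mult]
      bounded_bilinear.scaleR_left[OF bounded_bilinear_matrix_mult]
      bounded_bilinear.scaleR_right[OF bounded_bilinear_matrix_mult] matrix_mul_assoc
  show ?thesis
    unfolding ric_def[abs_def]
    by (rule derivative_eq_intros mult refl | simp only: simps)+
      (auto simp: fun_eq_iff simps algebra_simps)
qed


section \<open>Linear stochastic differential equations\<close>

text \<open>
  The time index ranges over \<^typ>\<open>real\<close>; only the values at nonnegative times matter.
\<close>

locale brownian_motion = prob_space M + filtration "space M" F
  for M :: "'w measure" and F :: "real \<Rightarrow> 'w measure" +
  fixes W :: "real \<Rightarrow> 'w \<Rightarrow> real"
  assumes subalgebra: "\<And>t. subalgebra M (F t)"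
    and adapted: "\<And>t. 0 \<le> t \<Longrightarrow> W t \<in> borel_measurable (F t)"
    and start: "\<And>\<omega>. \<omega> \<in> space M \<Longrightarrow> W 0 \<omega> = 0"
    and continuous_paths: "\<And>\<omega>. \<omega> \<in> space M \<Longrightarrow> continuous_on {0..} (\<lambda>t. W t \<omega>)"
    and normal_increments: "\<And>s t. 0 \<le> s \<Longrightarrow> s < t \<Longrightarrow>
      distributed M lborel (\<lambda>\<omega>. W t \<omega> - W s \<omega>) (normal_density 0 (sqrt (t - s)))"
    and independent_increments: "\<And>s t. 0 \<le> s \<Longrightarrow> s < t \<Longrightarrow>
      indep_set (sets (F s)) {(\<lambda>\<omega>. W t \<omega> - W s \<omega>) -` U \<inter> space M | U. U \<in> sets borel}"

text \<open>
  The triple \<open>(k, s, \<xi>)\<close> encodes the simple process that equals \<open>\<xi> i\<close> on the time interval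
  from \<open>s i\<close> (exclusive) to \<open>s (Suc i)\<close> (inclusive), for \<open>i < k\<close>, and 0 elsewhere.
\<close>

definition simple_data ::
    "(real \<Rightarrow> 'w measure) \<Rightarrow> nat \<times> (nat \<Rightarrow> real) \<times> (nat \<Rightarrow> 'w \<Rightarrow> 'a::euclidean_space) \<Rightarrow> bool"
  where "simple_data F = (\<lambda>(k, s, \<xi>). \<forall>i<k. 0 \<le> s i \<and> s i \<le> s (Suc i) \<and>
    \<xi> i \<in> borel_measurable (F (s i)) \<and> bounded (\<xi> i ` space (F (s i))))"

definition simple_process ::
    "nat \<times> (nat \<Rightarrow> real) \<times> (nat \<Rightarrow> 'w \<Rightarrow> 'a::euclidean_space) \<Rightarrow> real \<Rightarrow> 'w \<Rightarrow> 'a"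
  where "simple_process = (\<lambda>(k, s, \<xi>) t \<omega>. \<Sum>i<k. indicator {s i<..s (Suc i)} t *\<^sub>R \<xi> i \<omega>)"

definition simple_integral ::
    "(real \<Rightarrow> 'w \<Rightarrow> real) \<Rightarrow> nat \<times> (nat \<Rightarrow> real) \<times> (nat \<Rightarrow> 'w \<Rightarrow> 'a::euclidean_space)
      \<Rightarrow> real \<Rightarrow> 'w \<Rightarrow> 'a"
  where "simple_integral W = (\<lambda>(k, s, \<xi>) T \<omega>.
    \<Sum>i<k. (W (min T (s (Suc i))) \<omega> - W (min T (s i)) \<omega>) *\<^sub>R \<xi> i \<omega>)"

text \<open>
  The random variable \<open>I\<close> is (a version of) the Ito integral of \<open>H\<close> with respect to \<open>W\<close> over
  the interval from 0 to \<open>T\<close>: the mean-square limit of integrals of simple processes that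
  approximate \<open>H\<close> in the space of square-integrable processes.
\<close>

definition has_ito_integral ::
    "'w measure \<Rightarrow> (real \<Rightarrow> 'w measure) \<Rightarrow> (real \<Rightarrow> 'w \<Rightarrow> real) \<Rightarrow> real
      \<Rightarrow> (real \<Rightarrow> 'w \<Rightarrow> 'a::euclidean_space) \<Rightarrow> ('w \<Rightarrow> 'a) \<Rightarrow> bool"
  where "has_ito_integral M F W T H I \<longleftrightarrow>
    (\<lambda>(t, \<omega>). H t \<omega>) \<in> borel_measurable (restrict_space borel {0..T} \<Otimes>\<^sub>M F T) \<and>
    I \<in> borel_measurable M \<and>
    (\<exists>S. (\<forall>n. simple_data F (S n)) \<and>
      (\<lambda>n. \<integral>\<^sup>+\<omega>. (\<integral>\<^sup>+t\<in>{0..T}. ennreal ((norm (simple_process (S n) t \<omega> - H t \<omega>))\<^sup>2) \<partial>lborel) \<partial>M)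
        \<longlonglongrightarrow> 0 \<and>
      (\<lambda>n. \<integral>\<^sup>+\<omega>. ennreal ((norm (simple_integral W (S n) T \<omega> - I \<omega>))\<^sup>2) \<partial>M) \<longlonglongrightarrow> 0)"

text \<open>
  Strong solutions of \<open>dx = K x dt + L x dW\<close>, \<open>x(0) = x\<^sub>0\<close>.
\<close>

definition linear_sde_solution ::
    "'w measure \<Rightarrow> (real \<Rightarrow> 'w measure) \<Rightarrow> (real \<Rightarrow> 'w \<Rightarrow> real) \<Rightarrow> real^'n^'n \<Rightarrow> real^'n^'n
      \<Rightarrow> real^'n \<Rightarrow> (real \<Rightarrow> 'w \<Rightarrow> real^'n) \<Rightarrow> bool"
  where "linear_sde_solution M F W K L x\<^sub>0 x \<longleftrightarrow>
    (\<forall>t\<ge>0. x t \<in> borel_measurable (F t)) \<and>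
    (\<forall>\<omega>\<in>space M. continuous_on {0..} (\<lambda>t. x t \<omega>)) \<and>
    (\<forall>T\<ge>0. (\<integral>\<^sup>+\<omega>. (\<integral>\<^sup>+t\<in>{0..T}. ennreal ((norm (x t \<omega>))\<^sup>2) \<partial>lborel) \<partial>M) < \<infinity>) \<and>
    (\<forall>t\<ge>0. \<exists>I. has_ito_integral M F W t (\<lambda>s \<omega>. L *v x s \<omega>) I \<and>
      (AE \<omega> in M. x t \<omega> = x\<^sub>0 + integral {0..t} (\<lambda>s. K *v x s \<omega>) + I \<omega>))"

text \<open>
  The second moment is a nonnegative (Lebesgue) integral, so that an infinite second moment
  is not mistaken for 0.  The existence clause rules out vacuous stability.
\<close>

definition mean_square_stable ::
    "'w measure \<Rightarrow> (real \<Rightarrow> 'w measure) \<Rightarrow> (real \<Rightarrow> 'w \<Rightarrow> real) \<Rightarrow> real^'n^'n \<Rightarrow> real^'n^'n \<Rightarrow> bool"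
  where "mean_square_stable M F W K L \<longleftrightarrow>
    (\<forall>x\<^sub>0. (\<exists>x. linear_sde_solution M F W K L x\<^sub>0 x) \<and>
      (\<forall>x. linear_sde_solution M F W K L x\<^sub>0 x \<longrightarrow>
        ((\<lambda>t. \<integral>\<^sup>+\<omega>. ennreal ((norm (x t \<omega>))\<^sup>2) \<partial>M) \<longlongrightarrow> 0) at_top))"

definition stabilizing_solution ::
    "'w measure \<Rightarrow> (real \<Rightarrow> 'w measure) \<Rightarrow> (real \<Rightarrow> 'w \<Rightarrow> real)
      \<Rightarrow> real^'n^'n \<Rightarrow> real^'n^'n \<Rightarrow> real^'m^'n \<Rightarrow> real^'n^'r \<Rightarrow> real^'m^'q \<Rightarrow> real^'p^'n \<Rightarrow> real
      \<Rightarrow> real^'n^'n \<Rightarrow> bool"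
  where "stabilizing_solution M F W A A\<^sub>1 B C D E \<gamma> P \<longleftrightarrow>
    P \<in> psd_mats \<and> ric A A\<^sub>1 B C D E \<gamma> P = 0 \<and>
    mean_square_stable M F W (closed_loop A B D E \<gamma> P) A\<^sub>1"


section \<open>Admissible initial matrices\<close>

definition admissible_init :: "real^'n^'n \<Rightarrow> real \<Rightarrow> real \<Rightarrow> (real^'n^'n) set"
  where "admissible_init Pstar c\<^sub>0 a\<^sub>0 =
    {P \<in> psd_mats. norm (P - Pstar) \<le> (2 - sqrt 2) / (2 * c\<^sub>0 * a\<^sub>0)}"

end

theory Submission
  imports Defs
begin

text \<open>
  Both recursions express one linear equation in the next iterate. Write
  \<open>\<F>\<close> for the Riccati operator and \<open>\<F>'(P)\<close> for its derivative. The terms quadratic in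
  \<open>P\<close> occur once in \<open>\<F>(P)\<close> and, through the two closed-loop factors, twice in
  \<open>\<F>'(P) P\<close>; the policy weight carries them with the opposite sign, which yields
  \<open>\<F>'(P) P + policy weight = \<F>(P)\<close> (\<open>ric_deriv_self_plus_policy_weight\<close>).
  As \<open>\<F>'(P)\<close> is linear, the policy equation \<open>\<F>'(P) X + policy weight = 0\<close> says
  \<open>\<F>'(P) (P - X) = \<F>(P)\<close>. When \<open>\<F>'(P)\<close> is bijective on the symmetric matrices, this is
  the Newton step \<open>X = P - \<F>'(P)\<inverse> \<F>(P)\<close>
  (\<open>policy_update_iff_newton_step\<close>), and the equivalence of the two sequences follows index
  by index.
\<close>

lemma diff_in_sym_mats:
  assumes "X \<in> sym_mats" "Y \<in> sym_mats"
  shows "X - Y \<in> sym_mats"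
  using assms by (simp add: sym_mats_def transpose_diff')

lemma ric_deriv_diff:
  "ric_deriv A A\<^sub>1 B D E \<gamma> P (X - Y) = ric_deriv A A\<^sub>1 B D E \<gamma> P X - ric_deriv A A\<^sub>1 B D E \<gamma> P Y"
  by (simp add: ric_deriv_def bounded_bilinear.diff_left[OF bounded_bilinear_matrix_mult]
      bounded_bilinear.diff_right[OF bounded_bilinear_matrix_mult])

text \<open>
  Symmetry of \<open>P\<close> and of \<open>R\<inverse>\<close> is what makes the transposed closed-loop term
  contribute the same quadratic expression as the untransposed one.
\<close>

lemma ric_deriv_self_plus_policy_weight:
  fixes D :: "real^'m^'q"
  assumes "rank D = CARD('m)" "P \<in> sym_mats"
  shows "ric_deriv A A\<^sub>1 B D E \<gamma> P P + policy_weight B C D E \<gamma> P = ric A A\<^sub>1 B C D E \<gamma> P"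
proof -
  have P: "transpose P = P"
    using assms(2) by (simp add: sym_mats_def)
  note mult = bounded_bilinear_matrix_mult
  show ?thesis
    by (simp add: ric_deriv_def policy_weight_def ric_def closed_loop_def
        transpose_add' transpose_diff' transpose_scaleR' matrix_transpose_mul P
        transpose_matrix_inv_gram[OF assms(1)] matrix_mul_assoc
        bounded_bilinear.add_left[OF mult] bounded_bilinear.add_right[OF mult]
        bounded_bilinear.diff_left[OF mult] bounded_bilinear.diff_right[OF mult]
        bounded_bilinear.scaleR_left[OF mult] bounded_bilinear.scaleR_right[OF mult])
qed

lemma policy_update_iff_newton_step:
  fixes D :: "real^'m^'q"
  assumes rank: "rank D = CARD('m)"
    and P: "P \<in> sym_mats" and X: "X \<in> sym_mats"
    and bij: "bij_betw (ric_deriv A A\<^sub>1 B D E \<gamma> P) sym_mats sym_mats"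
  shows "ric_deriv A A\<^sub>1 B D E \<gamma> P X + policy_weight B C D E \<gamma> P = 0
    \<longleftrightarrow> X = P - ric_deriv_inv A A\<^sub>1 B D E \<gamma> P (ric A A\<^sub>1 B C D E \<gamma> P)"
proof -
  let ?L = "ric_deriv A A\<^sub>1 B D E \<gamma> P" and ?F = "ric A A\<^sub>1 B C D E \<gamma> P"
  have PX: "P - X \<in> sym_mats"
    using P X by (rule diff_in_sym_mats)
  have F: "?F \<in> sym_mats"
    using rank P by (rule ric_in_sym_mats)
  have "?L X + policy_weight B C D E \<gamma> P = 0 \<longleftrightarrow> ?L (P - X) = ?F"
    by (auto simp: ric_deriv_diff algebra_simps
        simp flip: ric_deriv_self_plus_policy_weight[OF rank P])
  \<comment> \<open>The inverse is taken within the symmetric matrices, so this step needs \<open>P - X\<close> and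
    \<open>\<F>(P)\<close> to be symmetric.\<close>
  also have "\<dots> \<longleftrightarrow> P - X = ric_deriv_inv A A\<^sub>1 B D E \<gamma> P ?F"
    unfolding ric_deriv_inv_def
    using bij_betw_inv_into_left[OF bij PX] bij_betw_inv_into_right[OF bij F] by metis
  also have "\<dots> \<longleftrightarrow> X = P - ric_deriv_inv A A\<^sub>1 B D E \<gamma> P ?F"
    by (auto simp: algebra_simps)
  finally show ?thesis .
qed

theorem lemma4:
  fixes A A\<^sub>1 :: "real^'n^'n"
    and B :: "real^'m^'n"
    and C :: "real^'n^'r"
    and D :: "real^'m^'q"
    and E :: "real^'p^'n"
    and \<gamma> c\<^sub>0 a\<^sub>0 :: real
    and Pstar :: "real^'n^'n"
    and P :: "nat \<Rightarrow> real^'n^'n"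
    and M :: "'w measure" and F :: "real \<Rightarrow> 'w measure" and W :: "real \<Rightarrow> 'w \<Rightarrow> real"
  assumes "rank D = CARD('m)"
    and "\<gamma> > 0"
    and "brownian_motion M F W"
    and "stabilizing_solution M F W A A\<^sub>1 B C D E \<gamma> Pstar"
    and "c\<^sub>0 > 0"
    and "\<And>X Y. X \<in> sym_mats \<Longrightarrow> Y \<in> sym_mats \<Longrightarrow>
      sym_onorm (\<lambda>\<Delta>. ric_deriv A A\<^sub>1 B D E \<gamma> X \<Delta> - ric_deriv A A\<^sub>1 B D E \<gamma> Y \<Delta>)
        \<le> c\<^sub>0 * norm (X - Y)"
    and "a\<^sub>0 > 0"
    and "bij_betw (ric_deriv A A\<^sub>1 B D E \<gamma> Pstar) sym_mats sym_mats"
    and "sym_onorm (ric_deriv_inv A A\<^sub>1 B D E \<gamma> Pstar) \<le> a\<^sub>0"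
    and "P 0 \<in> admissible_init Pstar c\<^sub>0 a\<^sub>0"
    and "\<And>i. P i \<in> sym_mats"
    and "\<And>i. bij_betw (ric_deriv A A\<^sub>1 B D E \<gamma> (P i)) sym_mats sym_mats"
  shows "(\<forall>i. P (Suc i) ** closed_loop A B D E \<gamma> (P i)
              + transpose (closed_loop A B D E \<gamma> (P i)) ** P (Suc i)
              + transpose A\<^sub>1 ** P (Suc i) ** A\<^sub>1
              + policy_weight B C D E \<gamma> (P i) = 0)
     \<longleftrightarrow> (\<forall>i. P (Suc i) = P i - ric_deriv_inv A A\<^sub>1 B D E \<gamma> (P i) (ric A A\<^sub>1 B C D E \<gamma> (P i)))"
  using policy_update_iff_newton_step[OF assms(1) assms(11) assms(11) assms(12), of _ "Suc _"]
  unfolding ric_deriv_def by blast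

end
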